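(* Let $k$ be a field. Let $X$ be the oriented graph with vertices $[p]$, $p\in\mathbb Z_{\ge 0}$, and edges $\varepsilon_p^i:[p-1]\to[p]$ ($p>0$, $0\le i\le p$) and $\eta_q^j:[q+1]\to[q]$ ($q\ge 0$, $0\le j\le q$). Let $S$ be the set of relations (for all indices for which the left-hand side is defined) $$f_{q+1,q}:\ \varepsilon_{q+1}^i\varepsilon_q^{j-1}=\varepsilon_{q+1}^j\varepsilon_q^i\quad (j>i),$$ $$g_{q,q+1}:\ \eta_q^j\eta_{q+1}^i=\eta_q^i\eta_{q+1}^{j+1}\quad (j\ge i),$$ $$h_{q-1,q}:\ \eta_{q-1}^j\varepsilon_q^i=\begin{cases}\varepsilon_{q-1}^i\eta_{q-2}^{j-1}, & j>i,\\ 1_{q-1}, & i=j \text{ or } i=j+1,\\ \varepsilon_{q-1}^{i-1}\eta_{q-2}^j, & i>j+1,\end{cases}$$ where $1_{q-1}$ is the identity of $[q-1]$. Then, with respect to the order $\succ_1$ on $C(X)$ (defined in the context), $S$ is a Gröbner–Shirshov basis for the category partial algebra $kC(X|S)$ (each relation $u=v$ being regarded as the polynomial $u-v\in kC(X)$).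
   Context: $C(X)$ is the free category on the graph $X$; we also write $C(X)$ for its set of morphisms, which are the paths ("words") in $X$ including the empty paths $1_v$. Words are composed right to left: $uv$ means first $v$, then $u$. Products are written only when defined. $kC(X)$, the free category partial algebra, consists of finite $k$-linear combinations of words with common domain and common codomain; multiplication extends composition linearly. $C(X|S)$ is the quotient of $C(X)$ by the congruence generated by $S$, and $kC(X|S)=kC(X)/Id(S)$, where $Id(S)$ is the set of finite linear combinations, with common domain and codomain, of products $asb$, $a,b\in C(X)$, $s\in S$. The category $C(X|S)$ is (a presentation of) the simplicial category. The index ranges: in $f_{q+1,q}$, $q\ge1$ and $0\le i<j\le q+1$; in $g_{q,q+1}$, $q\ge0$ and $0\le i\le j\le q$; in $h_{q-1,q}$, $q\ge 1$, $0\le j\le q-1$, $0\le i\le q$. The order $\succ_1$ on $C(X)$: (1) $\eta_p^i>\eta_q^j$ iff $p>q$, or $p=q$ and $i<j$. (2) For a word $u=\eta_{p_1}^{i_1}\eta_{p_2}^{i_2}\cdots\eta_{p_n}^{i_n}$ in the $\eta$'s ($n\ge0$; empty words allowed) put $wt(u)=(n,\eta_{p_n}^{i_n},\eta_{p_{n-1}}^{i_{n-1}},\dots,\eta_{p_1}^{i_1})$; two such words are compared by comparing weights lexicographically. (3) $\varepsilon_p^i>\varepsilon_q^j$ iff $p>q$, or $p=q$ and $i<j$. (4) Every $u\in C(X)$ is uniquely $u=v_0\varepsilon_{p_1}^{i_1}v_1\varepsilon_{p_2}^{i_2}\cdots\varepsilon_{p_n}^{i_n}v_n$, $n\ge 0$,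 with each $v_j$ a (possibly empty) word in the $\eta$'s; put $wt(u)=(n,v_0,v_1,\dots,v_n,\varepsilon_{p_1}^{i_1},\dots,\varepsilon_{p_n}^{i_n})$. Then $u\succ_1v$ iff $wt(u)>wt(v)$ lexicographically. Empty words at different vertices are ordered by $1_{[p]}>1_{[q]}$ iff $p>q$. This is a monomial order, i.e. a well ordering on $C(X)$ with $u>v\Rightarrow uw>vw,\ wu>wv$ whenever the products are defined. For nonzero $f\in kC(X)$, $\bar f$ is the largest word occurring in $f$ with nonzero coefficient; $f$ is monic if that coefficient is $1$. For a set $S$ of monic polynomials, an $S$-word is a defined product $asb$ with $a,b\in C(X)$, $s\in S$. Compositions of monic $f,g$: if $w=\bar f=a\bar gb$ ($a,b\in C(X)$), then $(f,g)_w=f-agb$; if $w=\bar fb=a\bar g$ ($a,b\in C(X)$), then $(f,g)_w=fb-ag$. $S$ is a Gröbner–Shirshov basis in $kC(X)$ (equivalently, for $kC(X|S)$) if every composition $(f,g)_w$ with $f,g\in S$ is trivial modulo $(S,w)$, i.e. $(f,g)_w=\sum\alpha_ia_is_ib_i$ (finite sum) with $\alpha_i\in k$, $a_is_ib_i$ $S$-words ($s_i\in S$) and $a_i\bar s_ib_i<w$. *)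

theory Defs
  imports "HOL-Library.Poly_Mapping" "Graph_Theory.Arc_Walk"
begin

section \<open>Free categories on graphs\<close>

text \<open>
  A word is composed right to left, so the letters of \<open>Word y es x\<close> form a path from
  \<open>x\<close> to \<open>y\<close> when read backwards. The endpoints are recorded in order to
  distinguish the empty words at different vertices.
\<close>

datatype ('v, 'e) word = Word (tgt: 'v) (letters: "'e list") (src: 'v)

definition free_cat :: "('v, 'e) pre_digraph \<Rightarrow> ('v, 'e) word set" where
  "free_cat X = {u. pre_digraph.awalk X (src u) (rev (letters u)) (tgt u)}"

definition id_word :: "'v \<Rightarrow> ('v, 'e) word" where
  "id_word v = Word v [] v"

definition arc_word :: "('v, 'e) pre_digraph \<Rightarrow> 'e \<Rightarrow> ('v, 'e) word" where
  "arc_word X e = Word (head X e) [e] (tail X e)"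

definition composable :: "('v, 'e) word \<Rightarrow> ('v, 'e) word \<Rightarrow> bool" where
  "composable u v \<longleftrightarrow> src u = tgt v"

text \<open>Only meaningful for composable words.\<close>

definition wcomp :: "('v, 'e) word \<Rightarrow> ('v, 'e) word \<Rightarrow> ('v, 'e) word"  (infixl "\<odot>" 70) where
  "u \<odot> v = Word (tgt u) (letters u @ letters v) (src v)"


section \<open>Free category partial algebras\<close>

text \<open>
  Linear combinations are finitely supported functions on words. The zero polynomials of
  the various hom-spaces are identified.
\<close>

definition free_palg :: "('v, 'e) pre_digraph \<Rightarrow> (('v, 'e) word \<Rightarrow>\<^sub>0 'k::field) set" where
  "free_palg X = {f. \<exists>x y. Poly_Mapping.keys f \<subseteq> {u \<in> free_cat X. src u = x \<and> tgt u = y}}"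

abbreviation mono_poly :: "('v, 'e) word \<Rightarrow> (('v, 'e) word \<Rightarrow>\<^sub>0 'k::field)" where
  "mono_poly u \<equiv> Poly_Mapping.single u 1"

text \<open>Only meaningful if the words of \<open>f\<close> are composable with those of \<open>g\<close>.\<close>

definition pmult :: "(('v, 'e) word \<Rightarrow>\<^sub>0 'k::field) \<Rightarrow> (('v, 'e) word \<Rightarrow>\<^sub>0 'k) \<Rightarrow> (('v, 'e) word \<Rightarrow>\<^sub>0 'k)"
    (infixl "\<otimes>\<^sub>p" 70) where
  "f \<otimes>\<^sub>p g = (\<Sum>u\<in>Poly_Mapping.keys f. \<Sum>v\<in>Poly_Mapping.keys g.
      Poly_Mapping.single (u \<odot> v) (Poly_Mapping.lookup f u * Poly_Mapping.lookup g v))"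

definition scale :: "'k::field \<Rightarrow> (('v, 'e) word \<Rightarrow>\<^sub>0 'k) \<Rightarrow> (('v, 'e) word \<Rightarrow>\<^sub>0 'k)" where
  "scale c f = Poly_Mapping.map ((*) c) f"


section \<open>Groebner--Shirshov bases\<close>

text \<open>
  A word order is given as the strict relation \<open>R\<close> of pairs (smaller word, larger word).
\<close>

definition lead :: "('v, 'e) word rel \<Rightarrow> (('v, 'e) word \<Rightarrow>\<^sub>0 'k::field) \<Rightarrow> ('v, 'e) word" where
  "lead R f = (THE w. w \<in> Poly_Mapping.keys f \<and>
      (\<forall>v\<in>Poly_Mapping.keys f. v \<noteq> w \<longrightarrow> (v, w) \<in> R))"

definition monic :: "('v, 'e) word rel \<Rightarrow> (('v, 'e) word \<Rightarrow>\<^sub>0 'k::field) \<Rightarrow> bool" where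
  "monic R f \<longleftrightarrow> f \<noteq> 0 \<and> Poly_Mapping.lookup f (lead R f) = 1"

text \<open>\<open>S_word X S a s b\<close> states that \<open>a s b\<close> is an \<open>S\<close>-word, in particular a defined product.\<close>

definition S_word :: "('v, 'e) pre_digraph \<Rightarrow> (('v, 'e) word \<Rightarrow>\<^sub>0 'k::field) set \<Rightarrow>
    ('v, 'e) word \<Rightarrow> (('v, 'e) word \<Rightarrow>\<^sub>0 'k) \<Rightarrow> ('v, 'e) word \<Rightarrow> bool" where
  "S_word X S a s b \<longleftrightarrow> a \<in> free_cat X \<and> b \<in> free_cat X \<and> s \<in> S \<and>
     (\<forall>u\<in>Poly_Mapping.keys s. composable a u \<and> composable u b)"

inductive composition :: "('v, 'e) pre_digraph \<Rightarrow> ('v, 'e) word rel \<Rightarrow>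
    (('v, 'e) word \<Rightarrow>\<^sub>0 'k::field) \<Rightarrow> (('v, 'e) word \<Rightarrow>\<^sub>0 'k) \<Rightarrow>
    ('v, 'e) word \<Rightarrow> (('v, 'e) word \<Rightarrow>\<^sub>0 'k) \<Rightarrow> bool"
  for X R f g where
  inclusion:
    "a \<in> free_cat X \<Longrightarrow> b \<in> free_cat X \<Longrightarrow>
     composable a (lead R g) \<Longrightarrow> composable (lead R g) b \<Longrightarrow>
     w = lead R f \<Longrightarrow> w = a \<odot> lead R g \<odot> b \<Longrightarrow>
     composition X R f g w (f - mono_poly a \<otimes>\<^sub>p g \<otimes>\<^sub>p mono_poly b)"
| intersection:
    "a \<in> free_cat X \<Longrightarrow> b \<in> free_cat X \<Longrightarrow>
     composable (lead R f) b \<Longrightarrow> composable a (lead R g) \<Longrightarrow>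
     w = lead R f \<odot> b \<Longrightarrow> w = a \<odot> lead R g \<Longrightarrow>
     composition X R f g w (f \<otimes>\<^sub>p mono_poly b - mono_poly a \<otimes>\<^sub>p g)"

text \<open>
  The endpoint conditions say that all summands lie in the hom-space of \<open>w\<close>, i.e. that
  the sum is defined in the partial algebra.
\<close>

definition trivial_mod :: "('v, 'e) pre_digraph \<Rightarrow> ('v, 'e) word rel \<Rightarrow>
    (('v, 'e) word \<Rightarrow>\<^sub>0 'k::field) set \<Rightarrow> ('v, 'e) word \<Rightarrow> (('v, 'e) word \<Rightarrow>\<^sub>0 'k) \<Rightarrow> bool" where
  "trivial_mod X R S w h \<longleftrightarrow>
     (\<exists>ts :: ('k \<times> ('v, 'e) word \<times> (('v, 'e) word \<Rightarrow>\<^sub>0 'k) \<times> ('v, 'e) word) list.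
        (\<forall>(c, a, s, b)\<in>set ts. S_word X S a s b \<and> tgt a = tgt w \<and> src b = src w \<and>
            (a \<odot> lead R s \<odot> b, w) \<in> R) \<and>
        h = (\<Sum>(c, a, s, b)\<leftarrow>ts. scale c (mono_poly a \<otimes>\<^sub>p s \<otimes>\<^sub>p mono_poly b)))"

definition gs_basis :: "('v, 'e) pre_digraph \<Rightarrow> ('v, 'e) word rel \<Rightarrow>
    (('v, 'e) word \<Rightarrow>\<^sub>0 'k::field) set \<Rightarrow> bool" where
  "gs_basis X R S \<longleftrightarrow> S \<subseteq> free_palg X \<and> (\<forall>s\<in>S. monic R s) \<and>
     (\<forall>f\<in>S. \<forall>g\<in>S. \<forall>w h. composition X R f g w h \<longrightarrow> trivial_mod X R S w h)"

definition rel_poly :: "('v, 'e) word \<times> ('v, 'e) word \<Rightarrow> (('v, 'e) word \<Rightarrow>\<^sub>0 'k::field)" where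
  "rel_poly = (\<lambda>(u, v). mono_poly u - mono_poly v)"


section \<open>The graph and the relations of the simplicial category\<close>

text \<open>
  \<open>Eps p i\<close> is the edge \<open>[p-1] \<rightarrow> [p]\<close> and \<open>Eta q j\<close> is the edge \<open>[q+1] \<rightarrow> [q]\<close>,
  with the superscript as second argument.
\<close>

datatype sarc = Eps nat nat | Eta nat nat

fun sarc_tail :: "sarc \<Rightarrow> nat" where
  "sarc_tail (Eps p i) = p - 1"
| "sarc_tail (Eta q j) = q + 1"

fun sarc_head :: "sarc \<Rightarrow> nat" where
  "sarc_head (Eps p i) = p"
| "sarc_head (Eta q j) = q"

definition simplicial_graph :: "(nat, sarc) pre_digraph" where
  "simplicial_graph = \<lparr> verts = UNIV,
     arcs = {Eps p i | p i. 0 < p \<and> i \<le> p} \<union> {Eta q j | q j. j \<le> q},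
     tail = sarc_tail, head = sarc_head \<rparr>"

type_synonym sword = "(nat, sarc) word"

abbreviation eps :: "nat \<Rightarrow> nat \<Rightarrow> sword" where
  "eps p i \<equiv> arc_word simplicial_graph (Eps p i)"

abbreviation eta :: "nat \<Rightarrow> nat \<Rightarrow> sword" where
  "eta q j \<equiv> arc_word simplicial_graph (Eta q j)"

text \<open>No subtraction below is truncated within the given index ranges.\<close>

definition f_rels :: "(sword \<times> sword) set" where
  "f_rels = {(eps (q + 1) i \<odot> eps q (j - 1), eps (q + 1) j \<odot> eps q i) | q i j.
     1 \<le> q \<and> i < j \<and> j \<le> q + 1}"

definition g_rels :: "(sword \<times> sword) set" where
  "g_rels = {(eta q j \<odot> eta (q + 1) i, eta q i \<odot> eta (q + 1) (j + 1)) | q i j.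
     i \<le> j \<and> j \<le> q}"

definition h_rhs :: "nat \<Rightarrow> nat \<Rightarrow> nat \<Rightarrow> sword" where
  "h_rhs q j i =
     (if j > i then eps (q - 1) i \<odot> eta (q - 2) (j - 1)
      else if i = j \<or> i = j + 1 then id_word (q - 1)
      else eps (q - 1) (i - 1) \<odot> eta (q - 2) j)"

definition h_rels :: "(sword \<times> sword) set" where
  "h_rels = {(eta (q - 1) j \<odot> eps q i, h_rhs q j i) | q j i.
     1 \<le> q \<and> j \<le> q - 1 \<and> i \<le> q}"

definition simplicial_relations :: "(sword \<times> sword) set" where
  "simplicial_relations = f_rels \<union> g_rels \<union> h_rels"


section \<open>The order on words\<close>

text \<open>As above, all relations consist of pairs (smaller, larger).\<close>

definition eta_less :: "sarc rel" where
  "eta_less = {(Eta q j, Eta p i) | p i q j. p > q \<or> p = q \<and> i < j}"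

definition eps_less :: "sarc rel" where
  "eps_less = {(Eps q j, Eps p i) | p i q j. p > q \<or> p = q \<and> i < j}"

text \<open>
  Words in the \<open>\<eta>\<close>'s are compared by length and then lexicographically from the right.
  The last component compares the empty words at different vertices; it has no effect on
  nonempty paths, whose endpoints are determined by their letters.
\<close>

definition eta_word_less :: "sword rel" where
  "eta_word_less = inv_image (less_than <*lex*> lex eta_less <*lex*> less_than)
     (\<lambda>v. (length (letters v), rev (letters v), tgt v))"

text \<open>
  If \<open>Word y es x\<close> decomposes as \<open>v\<^sub>0 \<epsilon> v\<^sub>1 \<dots> \<epsilon> v\<^sub>n\<close> with words \<open>v\<^sub>j\<close> in the \<open>\<eta>\<close>'s, then
  \<open>eta_words y es x\<close> is \<open>[v\<^sub>0, \<dots>, v\<^sub>n]\<close>, each \<open>v\<^sub>j\<close> with its proper endpoints, and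
  \<open>eps_letters es\<close> is the list of the \<open>n\<close> letters \<open>\<epsilon>\<close>.
\<close>

fun eta_words :: "nat \<Rightarrow> sarc list \<Rightarrow> nat \<Rightarrow> sword list" where
  "eta_words y [] x = [Word y [] x]"
| "eta_words y (Eps p i # es) x = Word y [] y # eta_words (p - 1) es x"
| "eta_words y (Eta q j # es) x =
     (let vs = eta_words (q + 1) es x
      in Word y (Eta q j # letters (hd vs)) (src (hd vs)) # tl vs)"

fun eps_letters :: "sarc list \<Rightarrow> sarc list" where
  "eps_letters [] = []"
| "eps_letters (Eps p i # es) = Eps p i # eps_letters es"
| "eps_letters (Eta q j # es) = eps_letters es"

text \<open>\<open>u \<succ>\<^sub>1 v\<close> is \<open>(v, u) \<in> word_less1\<close>. Lists are compared by \<^const>\<open>lex\<close> only when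
  their lengths agree.\<close>

definition word_less1 :: "sword rel" where
  "word_less1 = inv_image (less_than <*lex*> lex eta_word_less <*lex*> lex eps_less)
     (\<lambda>u. (length (eps_letters (letters u)),
           eta_words (tgt u) (letters u) (src u),
           eps_letters (letters u)))"

end

theory Submission
  imports Defs
begin

text \<open>
  All relations are binomials, so reducing by them is string rewriting on paths. A composition
  is trivial as soon as the two sides of the corresponding critical pair have a common reduct,
  because telescoping along the two reduction sequences writes it as a combination of \<open>S\<close>-words
  whose leading words lie below \<open>w\<close>; disjoint occurrences always have a common reduct. Every
  left-hand side has length two, which leaves the paths of length three
  \<open>\<epsilon>\<epsilon>\<epsilon>\<close>, \<open>\<eta>\<eta>\<eta>\<close>, \<open>\<eta>\<eta>\<epsilon>\<close> and \<open>\<eta>\<epsilon>\<epsilon>\<close> to be checked.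
\<close>

section \<open>Words of a free category\<close>

lemma word_sel_wcomp [simp]:
  "tgt (u \<odot> v) = tgt u" "letters (u \<odot> v) = letters u @ letters v" "src (u \<odot> v) = src v"
  by (simp_all add: wcomp_def)

lemma wcomp_assoc: "u \<odot> v \<odot> w = u \<odot> (v \<odot> w)"
  by (simp add: wcomp_def)

lemma word_sel_id_word [simp]: "tgt (id_word x) = x" "letters (id_word x) = []" "src (id_word x) = x"
  by (simp_all add: id_word_def)

lemma wcomp_id_word [simp]: "src u = x \<Longrightarrow> u \<odot> id_word x = u" "tgt u = x \<Longrightarrow> id_word x \<odot> u = u"
  by (auto simp: wcomp_def id_word_def intro: word.expand)

context wf_digraph
begin

lemma free_cat_Nil: "Word y [] x \<in> free_cat G \<longleftrightarrow> y = x \<and> x \<in> verts G"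
  by (auto simp: free_cat_def awalk_Nil_iff)

lemma free_cat_Cons:
  "Word y (e # es) x \<in> free_cat G \<longleftrightarrow> e \<in> arcs G \<and> head G e = y \<and> Word (tail G e) es x \<in> free_cat G"
  by (auto simp: free_cat_def awalk_simps)

lemma free_cat_append:
  "Word y (es @ fs) x \<in> free_cat G \<longleftrightarrow> (\<exists>z. Word y es z \<in> free_cat G \<and> Word z fs x \<in> free_cat G)"
proof (induction es arbitrary: y)
  case Nil
  have "Word y fs x \<in> free_cat G \<Longrightarrow> y \<in> verts G"
    using awalk_last_in_verts by (auto simp: free_cat_def)
  then show ?case by (auto simp: free_cat_Nil)
qed (auto simp: free_cat_Cons)

text \<open>A nonempty path ends at the head of its leftmost letter, an empty one at its source.
  This later identifies the vertex at which a path is cut.\<close>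

lemma free_cat_tgt_unique:
  assumes "Word y es x \<in> free_cat G" "Word y' es x \<in> free_cat G"
  shows "y = y'"
  using assms by (cases es) (auto simp: free_cat_Cons free_cat_Nil)

lemma free_cat_wcomp:
  "u \<in> free_cat G \<Longrightarrow> v \<in> free_cat G \<Longrightarrow> composable u v \<Longrightarrow> u \<odot> v \<in> free_cat G"
  by (cases u; cases v) (auto simp: wcomp_def composable_def free_cat_append)

lemma id_word_in_free_cat: "x \<in> verts G \<Longrightarrow> id_word x \<in> free_cat G"
  by (simp add: id_word_def free_cat_Nil)

lemma free_cat_ends:
  assumes "u \<in> free_cat G"
  shows "src u \<in> verts G" "tgt u \<in> verts G"
  using assms awalk_last_in_verts awalk_hd_in_verts by (auto simp: free_cat_def)

end


section \<open>Binomials\<close>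

lemma scale_uminus: "scale (- c) f = - scale c f"
  by (rule poly_mapping_eqI) (simp add: scale_def map.rep_eq when_def)

lemma scale_one: "scale 1 f = f"
  by (rule poly_mapping_eqI) (simp add: scale_def map.rep_eq when_def)

lemma keys_rel_poly:
  "u \<noteq> v \<Longrightarrow> Poly_Mapping.keys (rel_poly (u, v) :: ('v, 'e) word \<Rightarrow>\<^sub>0 'k::field) = {u, v}"
  by (auto simp: rel_poly_def in_keys_iff lookup_minus lookup_single when_def split: if_splits)

lemma rel_poly_self [simp]: "rel_poly (u, u) = 0"
  by (simp add: rel_poly_def)

lemma rel_poly_pmult:
  "rel_poly (u, v) \<otimes>\<^sub>p mono_poly b = (rel_poly (u \<odot> b, v \<odot> b) :: ('v, 'e) word \<Rightarrow>\<^sub>0 'k::field)"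
proof (cases "u = v")
  case False
  then show ?thesis unfolding pmult_def keys_rel_poly[OF False]
    by (simp add: rel_poly_def lookup_minus lookup_single when_def single_uminus)
qed (simp add: pmult_def)

lemma pmult_rel_poly:
  "mono_poly a \<otimes>\<^sub>p rel_poly (u, v) = (rel_poly (a \<odot> u, a \<odot> v) :: ('v, 'e) word \<Rightarrow>\<^sub>0 'k::field)"
proof (cases "u = v")
  case False
  then show ?thesis unfolding pmult_def keys_rel_poly[OF False]
    by (simp add: rel_poly_def lookup_minus lookup_single when_def single_uminus)
qed (simp add: pmult_def)

text \<open>Irreflexivity and transitivity exclude \<open>(u, v) \<in> R\<close>, so
  \<open>u\<close> alone meets the description in \<open>lead\<close>.\<close>

lemma lead_rel_poly:
  assumes "(v, u) \<in> R" "irrefl R" "trans R"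
  shows "lead R (rel_poly (u, v) :: ('v, 'e) word \<Rightarrow>\<^sub>0 'k::field) = u"
proof -
  have ne: "u \<noteq> v" and "(u, v) \<notin> R"
    using assms by (auto simp: irrefl_def dest: transD)
  then show ?thesis
    unfolding lead_def keys_rel_poly[OF ne] using assms(1) by (intro the_equality) auto
qed

lemma monic_rel_poly:
  assumes "(v, u) \<in> R" "irrefl R" "trans R"
  shows "monic R (rel_poly (u, v) :: ('v, 'e) word \<Rightarrow>\<^sub>0 'k::field)"
proof -
  have ne: "u \<noteq> v" using assms by (auto simp: irrefl_def)
  then have "rel_poly (u, v) \<noteq> (0 :: ('v, 'e) word \<Rightarrow>\<^sub>0 'k)"
    using keys_rel_poly[OF ne, where 'k='k] by auto
  then show ?thesis unfolding monic_def lead_rel_poly[OF assms]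
    using ne by (simp add: rel_poly_def lookup_minus lookup_single)
qed

section \<open>Closure of triviality modulo (S, w) under sums and differences\<close>

lemma trivial_mod_zero: "trivial_mod X R S w 0"
  unfolding trivial_mod_def by (rule exI[of _ "[]"]) simp

lemma trivial_mod_add:
  assumes "trivial_mod X R S w g" "trivial_mod X R S w h"
  shows "trivial_mod X R S w (g + h)"
proof -
  from assms obtain ts us where
    "\<forall>(c, a, s, b)\<in>set ts. S_word X S a s b \<and> tgt a = tgt w \<and> src b = src w \<and> (a \<odot> lead R s \<odot> b, w) \<in> R"
    "g = (\<Sum>(c, a, s, b)\<leftarrow>ts. scale c (mono_poly a \<otimes>\<^sub>p s \<otimes>\<^sub>p mono_poly b))"
    "\<forall>(c, a, s, b)\<in>set us. S_word X S a s b \<and> tgt a = tgt w \<and> src b = src w \<and> (a \<odot> lead R s \<odot> b, w) \<in> R"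
    "h = (\<Sum>(c, a, s, b)\<leftarrow>us. scale c (mono_poly a \<otimes>\<^sub>p s \<otimes>\<^sub>p mono_poly b))"
    unfolding trivial_mod_def by blast
  then show ?thesis unfolding trivial_mod_def by (intro exI[of _ "ts @ us"]) auto
qed

lemma trivial_mod_uminus:
  assumes "trivial_mod X R S w h"
  shows "trivial_mod X R S w (- h)"
proof -
  from assms obtain ts where ts:
    "\<forall>(c, a, s, b)\<in>set ts. S_word X S a s b \<and> tgt a = tgt w \<and> src b = src w \<and> (a \<odot> lead R s \<odot> b, w) \<in> R"
    "h = (\<Sum>(c, a, s, b)\<leftarrow>ts. scale c (mono_poly a \<otimes>\<^sub>p s \<otimes>\<^sub>p mono_poly b))"
    unfolding trivial_mod_def by blast
  have "- h = (\<Sum>(c, a, s, b)\<leftarrow>map (\<lambda>(c, t). (- c, t)) ts. scale c (mono_poly a \<otimes>\<^sub>p s \<otimes>\<^sub>p mono_poly b))"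
    unfolding ts(2) by (induction ts) (auto simp: scale_uminus)
  with ts(1) show ?thesis unfolding trivial_mod_def
    by (intro exI[of _ "map (\<lambda>(c, t). (- c, t)) ts"]) auto
qed

lemma trivial_mod_diff:
  "trivial_mod X R S w g \<Longrightarrow> trivial_mod X R S w h \<Longrightarrow> trivial_mod X R S w (g - h)"
  using trivial_mod_add[OF _ trivial_mod_uminus, of X R S w g h] by simp


section \<open>Decreasing systems of binomials\<close>

text \<open>Pairs in \<open>T\<close> are (larger, smaller), pairs in \<open>R\<close> are (smaller,
  larger). Monotonicity of the order enters through \<open>rule_decreasing\<close>, which compares
  the two sides of a rule in a context; this determines leading words and bounds the S-words along a
  reduction.\<close>

locale binomial_system = wf_digraph X
  for X :: "('v, 'e) pre_digraph" +
  fixes R :: "('v, 'e) word rel" and T :: "(('v, 'e) word \<times> ('v, 'e) word) set"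
  assumes irrefl: "irrefl R" and trans: "trans R"
    and rule_in_free_cat: "(u, v) \<in> T \<Longrightarrow> u \<in> free_cat X \<and> v \<in> free_cat X"
    and rule_parallel: "(u, v) \<in> T \<Longrightarrow> src u = src v \<and> tgt u = tgt v"
    and rule_decreasing: "(u, v) \<in> T \<Longrightarrow> a \<in> free_cat X \<Longrightarrow> b \<in> free_cat X \<Longrightarrow>
      composable a u \<Longrightarrow> composable u b \<Longrightarrow> (a \<odot> v \<odot> b, a \<odot> u \<odot> b) \<in> R"
begin

inductive rewr :: "('v, 'e) word \<Rightarrow> ('v, 'e) word \<Rightarrow> bool" where
  "(u, v) \<in> T \<Longrightarrow> a \<in> free_cat X \<Longrightarrow> b \<in> free_cat X \<Longrightarrow> composable a u \<Longrightarrow> composable u b \<Longrightarrow>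
    rewr (a \<odot> u \<odot> b) (a \<odot> v \<odot> b)"

lemma rewr_less: "rewr x y \<Longrightarrow> (y, x) \<in> R"
  by (auto elim!: rewr.cases intro: rule_decreasing)

lemma rule_less:
  assumes "(u, v) \<in> T"
  shows "(v, u) \<in> R"
proof -
  have "id_word (tgt u) \<in> free_cat X" "id_word (src u) \<in> free_cat X"
    using rule_in_free_cat[OF assms] by (auto intro: id_word_in_free_cat free_cat_ends)
  from rule_decreasing[OF assms this] rule_parallel[OF assms] show ?thesis
    by (simp add: composable_def)
qed

lemma rewr_rule_left:
  assumes "(u, v) \<in> T" "b \<in> free_cat X" "composable u b"
  shows "rewr (u \<odot> b) (v \<odot> b)"
proof -
  have "id_word (tgt u) \<in> free_cat X"
    using rule_in_free_cat[OF assms(1)] by (auto intro: id_word_in_free_cat free_cat_ends)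
  from rewr.intros[OF assms(1) this assms(2)] rule_parallel[OF assms(1)] assms(3) show ?thesis
    by (simp add: composable_def)
qed

lemma rewr_rule_right:
  assumes "(u, v) \<in> T" "a \<in> free_cat X" "composable a u"
  shows "rewr (a \<odot> u) (a \<odot> v)"
proof -
  have "id_word (src u) \<in> free_cat X"
    using rule_in_free_cat[OF assms(1)] by (auto intro: id_word_in_free_cat free_cat_ends)
  from rewr.intros[OF assms(1,2) this] rule_parallel[OF assms(1)] assms(3) show ?thesis
    by (simp add: composable_def)
qed

lemma rewr_wcomp_left:
  assumes "rewr x y" "c \<in> free_cat X" "composable c x"
  shows "rewr (c \<odot> x) (c \<odot> y)"
  using assms
proof (induction rule: rewr.induct)
  case (1 u v a b)
  then have "rewr (c \<odot> a \<odot> u \<odot> b) (c \<odot> a \<odot> v \<odot> b)"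
    by (intro rewr.intros free_cat_wcomp) (auto simp: composable_def)
  then show ?case by (simp add: wcomp_assoc)
qed

lemma rewr_parallel: "rewr x y \<Longrightarrow> src x = src y \<and> tgt x = tgt y"
  by (auto elim!: rewr.cases)

lemma lead_rule: "(u, v) \<in> T \<Longrightarrow> lead R (rel_poly (u, v) :: ('v, 'e) word \<Rightarrow>\<^sub>0 'k::field) = u"
  by (intro lead_rel_poly rule_less irrefl trans)

text \<open>With \<open>x = aub\<close> and \<open>y = avb\<close>, the difference
  \<open>x - y = a(u - v)b\<close> is a single S-word with leading word \<open>x\<close>, which lies
  below \<open>w\<close>.\<close>

lemma trivial_mod_rewr:
  assumes "rewr x y" "(x, w) \<in> R" "tgt x = tgt w" "src x = src w"
  shows "trivial_mod X R (rel_poly ` T) w (rel_poly (x, y) :: ('v, 'e) word \<Rightarrow>\<^sub>0 'k::field)"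
  using assms
proof (induction rule: rewr.induct)
  case (1 u v a b)
  let ?s = "rel_poly (u, v) :: ('v, 'e) word \<Rightarrow>\<^sub>0 'k"
  have "u \<noteq> v" using rule_less[OF 1(1)] irrefl by (auto simp: irrefl_def)
  then have "S_word X (rel_poly ` T) a ?s b"
    using 1 rule_parallel[OF 1(1)] by (auto simp: S_word_def keys_rel_poly composable_def)
  then show ?case unfolding trivial_mod_def
    using 1 by (intro exI[of _ "[(1, a, ?s, b)]"])
      (simp add: lead_rule scale_one rel_poly_pmult pmult_rel_poly)
qed

text \<open>Telescoping: \<open>x - z = (x - y) + (y - z)\<close>, where \<open>y\<close> is below
  \<open>x\<close> and hence below \<open>w\<close>.\<close>

lemma trivial_mod_rewrs:
  assumes "rewr\<^sup>*\<^sup>* x z" "(x, w) \<in> R" "tgt x = tgt w" "src x = src w"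
  shows "trivial_mod X R (rel_poly ` T) w (rel_poly (x, z) :: ('v, 'e) word \<Rightarrow>\<^sub>0 'k::field)"
  using assms
proof (induction rule: converse_rtranclp_induct)
  case base
  then show ?case by (simp add: trivial_mod_zero)
next
  case (step x y)
  have "trivial_mod X R (rel_poly ` T) w (rel_poly (y, z) :: ('v, 'e) word \<Rightarrow>\<^sub>0 'k)"
    using step.IH step.prems rewr_parallel[OF step.hyps(1)] rewr_less[OF step.hyps(1)] trans
    by (metis transD)
  from trivial_mod_add[OF trivial_mod_rewr[OF step.hyps(1) step.prems] this]
  show ?case by (simp add: rel_poly_def)
qed

lemma trivial_mod_joinable:
  assumes "rewr\<^sup>*\<^sup>* x z" "rewr\<^sup>*\<^sup>* y z" "(x, w) \<in> R" "(y, w) \<in> R"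
    and "tgt x = tgt w" "src x = src w" "tgt y = tgt w" "src y = src w"
  shows "trivial_mod X R (rel_poly ` T) w (rel_poly (x, y) :: ('v, 'e) word \<Rightarrow>\<^sub>0 'k::field)"
  using trivial_mod_diff[OF trivial_mod_rewrs[OF assms(1,3,5,6)] trivial_mod_rewrs[OF assms(2,4,7,8)]]
  by (simp add: rel_poly_def)

text \<open>By \<open>le\<close>, \<open>u'\<close> lies inside \<open>b\<close>, so the common word
  is \<open>u c u'\<close> for some path \<open>c\<close>. Applying the two rules in either order
  gives \<open>v c v'\<close>.\<close>

lemma disjoint_joinable:
  assumes "(u, v) \<in> T" "(u', v') \<in> T" "a \<in> free_cat X" "b \<in> free_cat X"
    and "composable u b" "composable a u'" and eq: "u \<odot> b = a \<odot> u'"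
    and le: "length (letters u') \<le> length (letters b)"
  shows "\<exists>z. rewr\<^sup>*\<^sup>* (v \<odot> b) z \<and> rewr\<^sup>*\<^sup>* (a \<odot> v') z"
proof -
  have ends: "tgt u = tgt a" "src b = src u'" and ls: "letters u @ letters b = letters a @ letters u'"
    using arg_cong[OF eq, of tgt] arg_cong[OF eq, of src] arg_cong[OF eq, of letters] by simp_all
  have "length (letters u) \<le> length (letters a)"
    using le arg_cong[OF ls, of length] by simp
  with ls obtain cs where cs: "letters b = cs @ letters u'" "letters a = letters u @ cs"
    by (metis append_eq_append_conv_if append_take_drop_id)
  \<comment> \<open>The middle factor may be empty, so its endpoints are taken from its
    neighbours.\<close>
  define c where "c = Word (src u) cs (tgt u')"
  have b: "b = c \<odot> u'" and a: "a = u \<odot> c"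
    using cs ends assms(5,6) by (auto simp: c_def wcomp_def composable_def intro: word.expand)
  have par: "src u = src v" "tgt u = tgt v" "src u' = src v'" "tgt u' = tgt v'"
    using rule_parallel assms(1,2) by auto
  have u: "u \<in> free_cat X" "v \<in> free_cat X" "u' \<in> free_cat X" "v' \<in> free_cat X"
    using rule_in_free_cat assms(1,2) by auto
  \<comment> \<open>To see that \<open>c\<close> is a path, cut the path \<open>b\<close> at some
    \<open>z\<close>; the right part \<open>letters u'\<close> forces \<open>z\<close> to be the
    target of \<open>u'\<close>.\<close>
  obtain z where z: "Word (tgt b) cs z \<in> free_cat X" "Word z (letters u') (src b) \<in> free_cat X"
    using assms(4) cs(1) free_cat_append[of "tgt b" cs "letters u'" "src b"] by (cases b) auto
  have "z = tgt u'"
    using free_cat_tgt_unique[OF z(2)] u(3) ends by (cases u') auto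
  then have c: "c \<in> free_cat X" using z(1) assms(5) by (simp add: c_def composable_def)
  have "rewr (v \<odot> c \<odot> u') (v \<odot> c \<odot> v')"
    using c u par assms(2) by (intro rewr_rule_right free_cat_wcomp) (auto simp: c_def composable_def)
  moreover have "rewr (u \<odot> (c \<odot> v')) (v \<odot> (c \<odot> v'))"
    using c u par assms(1) by (intro rewr_rule_left free_cat_wcomp) (auto simp: c_def composable_def)
  ultimately show ?thesis unfolding a b by (auto simp: wcomp_assoc)
qed

text \<open>In a composition the word \<open>w\<close> itself cancels, leaving the difference of two
  one-step reducts of \<open>w\<close>. The assumption \<open>overlap\<close> speaks of proper
  overlaps only; the other intersections are handled by \<open>disjoint_joinable\<close>.\<close>

theorem gs_basis_of_joinable:
  assumes inclusion: "\<And>u v u' v' a b. (u, v) \<in> T \<Longrightarrow> (u', v') \<in> T \<Longrightarrow>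
      a \<in> free_cat X \<Longrightarrow> b \<in> free_cat X \<Longrightarrow> composable a u' \<Longrightarrow> composable u' b \<Longrightarrow>
      u = a \<odot> u' \<odot> b \<Longrightarrow> \<exists>z. rewr\<^sup>*\<^sup>* v z \<and> rewr\<^sup>*\<^sup>* (a \<odot> v' \<odot> b) z"
    and overlap: "\<And>u v u' v' a b. (u, v) \<in> T \<Longrightarrow> (u', v') \<in> T \<Longrightarrow>
      a \<in> free_cat X \<Longrightarrow> b \<in> free_cat X \<Longrightarrow> composable u b \<Longrightarrow> composable a u' \<Longrightarrow>
      u \<odot> b = a \<odot> u' \<Longrightarrow> length (letters b) < length (letters u') \<Longrightarrow>
      \<exists>z. rewr\<^sup>*\<^sup>* (v \<odot> b) z \<and> rewr\<^sup>*\<^sup>* (a \<odot> v') z"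
  shows "gs_basis X R (rel_poly ` T :: (('v, 'e) word \<Rightarrow>\<^sub>0 'k::field) set)"
  unfolding gs_basis_def
proof (intro conjI ballI allI impI)
  show "rel_poly ` T \<subseteq> (free_palg X :: (('v, 'e) word \<Rightarrow>\<^sub>0 'k) set)"
  proof
    fix f :: "('v, 'e) word \<Rightarrow>\<^sub>0 'k" assume "f \<in> rel_poly ` T"
    then obtain u v where uv: "(u, v) \<in> T" "f = rel_poly (u, v)" by auto
    have "u \<noteq> v" using rule_less[OF uv(1)] irrefl by (auto simp: irrefl_def)
    then have "Poly_Mapping.keys f = {u, v}" using uv(2) by (simp add: keys_rel_poly)
    then show "f \<in> free_palg X"
      using rule_in_free_cat[OF uv(1)] rule_parallel[OF uv(1)] by (auto simp: free_palg_def)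
  qed
next
  fix f :: "('v, 'e) word \<Rightarrow>\<^sub>0 'k" assume "f \<in> rel_poly ` T"
  then show "monic R f" using monic_rel_poly rule_less irrefl trans by fastforce
next
  fix f g h :: "('v, 'e) word \<Rightarrow>\<^sub>0 'k" and w
  assume "f \<in> rel_poly ` T" "g \<in> rel_poly ` T" and comp: "composition X R f g w h"
  then obtain u v u' v' where T: "(u, v) \<in> T" "(u', v') \<in> T"
    and f: "f = rel_poly (u, v)" and g: "g = rel_poly (u', v')" by auto
  note [simp] = f g lead_rule[OF T(1)] lead_rule[OF T(2)]
  have par: "src u = src v" "tgt u = tgt v" "src u' = src v'" "tgt u' = tgt v'"
    using rule_parallel T by auto
  from comp show "trivial_mod X R (rel_poly ` T) w h"
  proof cases
    case (inclusion a b)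
    then have w: "w = u" "u = a \<odot> u' \<odot> b" and cond: "a \<in> free_cat X" "b \<in> free_cat X"
      "composable a u'" "composable u' b" by auto
    obtain z where z: "rewr\<^sup>*\<^sup>* v z" "rewr\<^sup>*\<^sup>* (a \<odot> v' \<odot> b) z"
      using assms(1)[OF T cond w(2)] by blast
    have "(a \<odot> v' \<odot> b, w) \<in> R" unfolding w using T(2) cond by (rule rule_decreasing)
    moreover have "(v, w) \<in> R" unfolding w(1) using T(1) by (rule rule_less)
    ultimately have "trivial_mod X R (rel_poly ` T) w (rel_poly (a \<odot> v' \<odot> b, v) :: ('v, 'e) word \<Rightarrow>\<^sub>0 'k)"
      using z par w by (intro trivial_mod_joinable[of _ z]) auto
    moreover have "h = rel_poly (a \<odot> v' \<odot> b, v)"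
      using inclusion(1) w(2) by (simp add: pmult_rel_poly rel_poly_pmult) (simp add: rel_poly_def)
    ultimately show ?thesis by simp
  next
    case (intersection a b)
    then have w: "w = u \<odot> b" "u \<odot> b = a \<odot> u'" and cond: "a \<in> free_cat X" "b \<in> free_cat X"
      "composable u b" "composable a u'" by auto
    obtain z where z: "rewr\<^sup>*\<^sup>* (v \<odot> b) z" "rewr\<^sup>*\<^sup>* (a \<odot> v') z"
      using assms(2)[OF T cond w(2)] disjoint_joinable[OF T cond w(2)] by (meson not_less)
    have "(v \<odot> b, w) \<in> R" unfolding w(1)
      by (intro rewr_less rewr_rule_left T cond)
    moreover have "(a \<odot> v', w) \<in> R" unfolding w
      by (intro rewr_less rewr_rule_right T cond)
    moreover have "tgt u = tgt a" "src b = src u'"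
      using arg_cong[OF w(2), of tgt] arg_cong[OF w(2), of src] by simp_all
    ultimately have "trivial_mod X R (rel_poly ` T) w (rel_poly (a \<odot> v', v \<odot> b) :: ('v, 'e) word \<Rightarrow>\<^sub>0 'k)"
      using z par w by (intro trivial_mod_joinable[of _ z]) auto
    moreover have "h = rel_poly (a \<odot> v', v \<odot> b)"
      using intersection(1) w(2) by (simp add: pmult_rel_poly rel_poly_pmult) (simp add: rel_poly_def)
    ultimately show ?thesis by simp
  qed
qed

end

section \<open>String rewriting for the simplicial relations\<close>

text \<open>
  The indices are shifted with respect to \<^const>\<open>simplicial_relations\<close> so that no
  subtraction occurs.
\<close>

inductive srule :: "sarc list \<Rightarrow> sarc list \<Rightarrow> bool" where
  f: "1 \<le> q \<Longrightarrow> i \<le> j \<Longrightarrow> j \<le> q \<Longrightarrow> srule [Eps (Suc q) i, Eps q j] [Eps (Suc q) (Suc j), Eps q i]"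
| g: "i \<le> j \<Longrightarrow> j \<le> q \<Longrightarrow> srule [Eta q j, Eta (Suc q) i] [Eta q i, Eta (Suc q) (Suc j)]"
| h_less: "i \<le> j \<Longrightarrow> j \<le> q \<Longrightarrow>
    srule [Eta (Suc q) (Suc j), Eps (Suc (Suc q)) i] [Eps (Suc q) i, Eta q j]"
| h_id: "i = j \<or> i = Suc j \<Longrightarrow> j \<le> q \<Longrightarrow> srule [Eta q j, Eps (Suc q) i] []"
| h_greater: "j < i \<Longrightarrow> i \<le> Suc q \<Longrightarrow>
    srule [Eta (Suc q) j, Eps (Suc (Suc q)) (Suc i)] [Eps (Suc q) i, Eta q j]"

text \<open>Endpoints are dropped, so that critical pairs become computations with lists of letters.
  Left contexts grow letter by letter, which reduces compatibility with them to prefixing one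
  letter.\<close>

inductive sred :: "sarc list \<Rightarrow> sarc list \<Rightarrow> bool" where
  rule: "srule l r \<Longrightarrow> sred (l @ es) (r @ es)"
| Cons: "sred es es' \<Longrightarrow> sred (e # es) (e # es')"

text \<open>The three \<open>h\<close> rules have disjoint ranges: the superscript of the epsilon is
  below that of the eta, equal to it or one above, or larger still.\<close>

lemma srule_functional: "srule l r \<Longrightarrow> srule l r' \<Longrightarrow> r = r'"
  by (auto elim!: srule.cases)

lemma srule_length: "srule l r \<Longrightarrow> length l = 2"
  by (auto elim!: srule.cases)

section \<open>Dictionary between the simplicial relations and the string rules\<close>

interpretation simplicial: wf_digraph simplicial_graph
  by unfold_locales (auto simp: simplicial_graph_def)

lemma simplicial_graph_simps [simp]:
  "verts simplicial_graph = UNIV" "tail simplicial_graph = sarc_tail" "head simplicial_graph = sarc_head"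
  "Eps p i \<in> arcs simplicial_graph \<longleftrightarrow> 0 < p \<and> i \<le> p" "Eta q j \<in> arcs simplicial_graph \<longleftrightarrow> j \<le> q"
  by (auto simp: simplicial_graph_def)

lemmas sword_simps =
  arc_word_def id_word_def wcomp_def simplicial.free_cat_Cons simplicial.free_cat_Nil

lemma simplicial_relationsD:
  assumes "(u, v) \<in> simplicial_relations"
  shows "u \<in> free_cat simplicial_graph \<and> v \<in> free_cat simplicial_graph \<and>
    src u = src v \<and> tgt u = tgt v \<and> srule (letters u) (letters v)"
proof -
  consider "(u, v) \<in> f_rels" | "(u, v) \<in> g_rels" | "(u, v) \<in> h_rels"
    using assms by (auto simp: simplicial_relations_def)
  then show ?thesis
  proof cases
    case 1
    then obtain q i j' where "1 \<le> q" "i < j'" "j' \<le> q + 1"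
      and "u = eps (q + 1) i \<odot> eps q (j' - 1)" "v = eps (q + 1) j' \<odot> eps q i"
      unfolding f_rels_def by blast
    moreover from this obtain j where "j' = Suc j" by (cases j') auto
    ultimately show ?thesis
      using srule.f[of q i j]
      by (auto simp: sword_simps)
  next
    case 2
    then show ?thesis unfolding g_rels_def
      by (auto simp: sword_simps
          intro: srule.g)
  next
    case 3
    then obtain q' j i where "1 \<le> q'" "j \<le> q' - 1" "i \<le> q'"
      and "u = eta (q' - 1) j \<odot> eps q' i" "v = h_rhs q' j i"
      unfolding h_rels_def by blast
    moreover from this obtain q where "q' = Suc q" by (cases q') auto
    ultimately have q: "j \<le> q" "i \<le> Suc q"
      and u: "u = eta q j \<odot> eps (Suc q) i" and v: "v = h_rhs (Suc q) j i" by auto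
    \<comment> \<open>These are the cases \<open>i < j\<close>, \<open>i = j\<close> or
      \<open>i = j + 1\<close>, and \<open>i > j + 1\<close>. In the outer two \<open>q\<close> is
      positive, so the subtractions in \<open>h_rhs\<close> can be resolved.\<close>
    consider (less) r k where "q = Suc r" "j = Suc k" "i \<le> k" "k \<le> r"
      | (id) "i = j \<or> i = Suc j"
      | (greater) r k where "q = Suc r" "i = Suc k" "j < k" "k \<le> Suc r"
      using q by (cases q; cases i; cases j) force+
    then show ?thesis
    proof cases
      case less
      then show ?thesis using u v srule.h_less[of i k r]
        by (auto simp: h_rhs_def sword_simps)
    next
      case id
      then show ?thesis using u v q srule.h_id[of i j q]
        by (auto simp: h_rhs_def sword_simps)
    next
      case greater
      then show ?thesis using u v srule.h_greater[of j k r]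
        by (auto simp: h_rhs_def sword_simps)
    qed
  qed
qed

text \<open>Strings carry no endpoints, but being a path forces \<open>y\<close> and
  \<open>x\<close> to be the head of the first and the tail of the last letter, which are the
  endpoints of the relation with these letters.\<close>

lemma simplicial_relationsI:
  assumes "srule l r" "Word y l x \<in> free_cat simplicial_graph"
  shows "(Word y l x, Word y r x) \<in> simplicial_relations"
  using assms
proof cases
  case (f q i j)
  have "(eps (q + 1) i \<odot> eps q (Suc j - 1), eps (q + 1) (Suc j) \<odot> eps q i) \<in> f_rels"
    unfolding f_rels_def using f by (intro CollectI exI conjI refl) auto
  then show ?thesis using f assms(2)
    by (auto simp: simplicial_relations_def sword_simps)
next
  case (g i j q)
  have "(eta q j \<odot> eta (q + 1) i, eta q i \<odot> eta (q + 1) (j + 1)) \<in> g_rels"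
    unfolding g_rels_def using g(3,4) by blast
  then show ?thesis using g assms(2)
    by (auto simp: simplicial_relations_def sword_simps)
next
  case (h_less i j q)
  have "(eta (Suc (Suc q) - 1) (Suc j) \<odot> eps (Suc (Suc q)) i, h_rhs (Suc (Suc q)) (Suc j) i) \<in> h_rels"
    unfolding h_rels_def using h_less
    by (intro CollectI exI[of _ "Suc (Suc q)"] exI[of _ "Suc j"] exI[of _ i]) auto
  then show ?thesis using h_less assms(2)
    by (auto simp: simplicial_relations_def h_rhs_def sword_simps)
next
  case (h_id i j q)
  have "(eta (Suc q - 1) j \<odot> eps (Suc q) i, h_rhs (Suc q) j i) \<in> h_rels"
    unfolding h_rels_def using h_id
    by (intro CollectI exI[of _ "Suc q"] exI[of _ j] exI[of _ i]) auto
  then show ?thesis using h_id assms(2)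
    by (auto simp: simplicial_relations_def h_rhs_def sword_simps)
next
  case (h_greater j i q)
  have "(eta (Suc (Suc q) - 1) j \<odot> eps (Suc (Suc q)) (Suc i), h_rhs (Suc (Suc q)) j (Suc i)) \<in> h_rels"
    unfolding h_rels_def using h_greater
    by (intro CollectI exI[of _ "Suc (Suc q)"] exI[of _ j] exI[of _ "Suc i"]) auto
  then show ?thesis using h_greater assms(2)
    by (auto simp: simplicial_relations_def h_rhs_def sword_simps)
qed


section \<open>The order on words\<close>

lemma irrefl_word_less1: "irrefl word_less1"
proof -
  have "irrefl eta_less" "irrefl eps_less" "irrefl less_than"
    by (auto simp: irrefl_def eta_less_def eps_less_def)
  moreover from this have "irrefl eta_word_less"
    unfolding eta_word_less_def by (auto simp: irrefl_def[of "inv_image _ _"])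
  ultimately show ?thesis
    unfolding word_less1_def by (auto simp: irrefl_def[of "inv_image _ _"])
qed

lemma trans_word_less1: "trans word_less1"
proof -
  have "trans eta_less" "trans eps_less"
    by (auto simp: trans_def eta_less_def eps_less_def)
  then show ?thesis unfolding word_less1_def eta_word_less_def
    by (intro trans_inv_image trans_lex_prod lex_transI trans_less_than)
qed

lemma length_eta_words: "length (eta_words y es x) = Suc (length (eps_letters es))"
  by (induction y es x rule: eta_words.induct) (auto simp: Let_def)

lemma eta_words_nonempty: "eta_words y es x \<noteq> []"
  using length_eta_words[of y es x] by auto

lemma tgt_hd_eta_words: "tgt (hd (eta_words y es x)) = y"
  by (induction y es x rule: eta_words.induct) (auto simp: Let_def)

text \<open>An epsilon in front adds equal first components on both sides. An eta in front lengthens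
  both first eta words by one and, these being read from the right, is compared last.\<close>

lemma word_less1_Cons:
  assumes "(Word (sarc_tail e) fs x, Word (sarc_tail e) es x) \<in> word_less1"
  shows "(Word y (e # fs) x, Word y (e # es) x) \<in> word_less1"
proof (cases e)
  case (Eps p i)
  have "irrefl eta_word_less" "irrefl eps_less"
    by (auto simp: irrefl_def eta_word_less_def eta_less_def eps_less_def)
  then show ?thesis using assms Eps by (auto simp: word_less1_def irrefl_def)
next
  case (Eta q j)
  obtain v vs where v: "eta_words (Suc q) fs x = v # vs"
    using eta_words_nonempty by (cases "eta_words (Suc q) fs x") auto
  obtain w ws where w: "eta_words (Suc q) es x = w # ws"
    using eta_words_nonempty by (cases "eta_words (Suc q) es x") auto
  \<comment> \<open>Otherwise \<open>v\<close> and \<open>w\<close> might be ordered by their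
    targets alone, a difference that prefixing a letter would erase.\<close>
  have tgt: "tgt v = tgt w"
    using tgt_hd_eta_words[of "Suc q" es x] tgt_hd_eta_words[of "Suc q" fs x] v w by simp
  have "(Word y (Eta q j # letters v) (src v), Word y (Eta q j # letters w) (src w)) \<in> eta_word_less"
    if "(v, w) \<in> eta_word_less"
    using that tgt by (auto simp: eta_word_less_def intro: lex_append_rightI)
  then show ?thesis using assms Eta v w by (auto simp: word_less1_def)
qed

text \<open>The deciding component is the first epsilon for \<open>f\<close> and the right one of
  the two etas for \<open>g\<close>, in both cases by \<open>i < Suc j\<close>; for
  \<open>h_less\<close> and \<open>h_greater\<close> it is the first eta word, which becomes
  shorter, and for \<open>h_id\<close> the number of epsilons.\<close>

lemma srule_word_less1:
  assumes "srule l r"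
  shows "(Word y (r @ es) x, Word y (l @ es) x) \<in> word_less1"
  using assms
proof cases
  case (g i j q)
  then show ?thesis
    by (auto simp: word_less1_def Let_def eta_word_less_def eta_less_def length_eta_words
        intro!: lex_append_leftI)
qed (auto simp: word_less1_def Let_def eta_word_less_def eps_less_def length_eta_words)

lemma sred_word_less1:
  assumes "sred es es'"
  shows "(Word y es' x, Word y es x) \<in> word_less1"
  using assms
  by (induction arbitrary: y rule: sred.induct) (auto intro: srule_word_less1 word_less1_Cons)

section \<open>Critical pairs\<close>

lemma sreds_rule: "srule l r \<Longrightarrow> sred\<^sup>*\<^sup>* (r @ es) s \<Longrightarrow> sred\<^sup>*\<^sup>* (l @ es) s"
  by (blast intro: converse_rtranclp_into_rtranclp sred.rule)

lemma sreds_Cons_rule: "srule l r \<Longrightarrow> sred\<^sup>*\<^sup>* (e # r @ es) s \<Longrightarrow> sred\<^sup>*\<^sup>* (e # l @ es) s"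
  by (blast intro: converse_rtranclp_into_rtranclp sred.intros)

text \<open>Backward-chaining forms of the five rules at the first and second position, the only
  possible places for a left-hand side of length two in a string of three letters.\<close>

lemmas sreds_head = srule.intros[THEN sreds_rule, simplified append_Cons append_Nil]
lemmas sreds_second = srule.intros[THEN sreds_Cons_rule, simplified append_Cons append_Nil]
lemmas sreds_intros = sreds_head sreds_second rtranclp.rtrancl_refl

text \<open>The source is \<open>\<epsilon>\<epsilon>\<epsilon>\<close> with superscripts
  \<open>i \<le> j \<le> k\<close>. Both sides sort them into decreasing order, each gaining one for
  every letter it passes on its way left: \<open>k + 2, j + 1, i\<close>.\<close>

lemma critical_pair_ff:
  assumes "1 \<le> q" "i \<le> j" "j \<le> k" "k \<le> q"
  shows "\<exists>s. sred\<^sup>*\<^sup>* [Eps (Suc (Suc q)) (Suc j), Eps (Suc q) i, Eps q k] s \<and>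
    sred\<^sup>*\<^sup>* [Eps (Suc (Suc q)) i, Eps (Suc q) (Suc k), Eps q j] s"
  by (rule exI[of _ "[Eps (Suc (Suc q)) (Suc (Suc k)), Eps (Suc q) (Suc j), Eps q i]"])
    (use assms in \<open>fastforce intro: sreds_intros\<close>)

text \<open>The source is \<open>\<eta>\<eta>\<eta>\<close> with superscripts
  \<open>k \<ge> j \<ge> i\<close>. Now the order becomes increasing, with a gain of one for every
  letter passed on the way right: \<open>i, j + 1, k + 2\<close>.\<close>

lemma critical_pair_gg:
  assumes "i \<le> j" "j \<le> k" "k \<le> q"
  shows "\<exists>s. sred\<^sup>*\<^sup>* [Eta q j, Eta (Suc q) (Suc k), Eta (Suc (Suc q)) i] s \<and>
    sred\<^sup>*\<^sup>* [Eta q k, Eta (Suc q) i, Eta (Suc (Suc q)) (Suc j)] s"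
  by (rule exI[of _ "[Eta q i, Eta (Suc q) (Suc j), Eta (Suc (Suc q)) (Suc (Suc k))]"])
    (use assms in \<open>fastforce intro: sreds_intros\<close>)

text \<open>The source is \<open>[Eta q k, Eta (Suc q) j, Eps (Suc (Suc q)) i]\<close>. The epsilon
  moves left past both etas or cancels against one; if both survive, \<open>g\<close> sorts them on
  the side where \<open>h\<close> came first.\<close>

lemma critical_pair_gh:
  assumes "j \<le> k" "k \<le> q" and "srule [Eta (Suc q) j, Eps (Suc (Suc q)) i] r"
  shows "\<exists>s. sred\<^sup>*\<^sup>* [Eta q j, Eta (Suc q) (Suc k), Eps (Suc (Suc q)) i] s \<and> sred\<^sup>*\<^sup>* (Eta q k # r) s"
  using assms(3)
proof cases
  case (h_less j')
  obtain k' q' where [simp]: "k = Suc k'" "q = Suc q'"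
    using h_less assms(1,2) by (cases k; cases q) auto
  show ?thesis
    by (rule exI[of _ "[Eps (Suc q') i, Eta q' j', Eta (Suc q') (Suc k')]"])
      (use h_less assms in \<open>fastforce intro: sreds_intros\<close>)
next
  case h_id
  have "sred\<^sup>*\<^sup>* [Eta q j, Eta (Suc q) (Suc k), Eps (Suc (Suc q)) i] [Eta q k]"
  proof (cases "i \<le> k")
    case True
    then show ?thesis using h_id assms(1,2) by (fastforce intro: sreds_intros)
  next
    case False
    then have "i = Suc k" "j = k" using h_id assms(1) by auto
    then show ?thesis using assms(2) by (fastforce intro: sreds_intros)
  qed
  then show ?thesis using h_id by auto
next
  case (h_greater i')
  \<comment> \<open>Comparing \<open>i'\<close> with \<open>k\<close> on one side amounts to
    comparing \<open>i = Suc i'\<close> with \<open>Suc k\<close> on the other, so both sides pass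
    or cancel together.\<close>
  consider (less) "i' < k" | (id) "i' = k \<or> i' = Suc k" | (greater) "Suc k < i'" by linarith
  then show ?thesis
  proof cases
    case less
    obtain k' q' where [simp]: "k = Suc k'" "q = Suc q'"
      using less assms(2) by (cases k; cases q) auto
    show ?thesis
      by (rule exI[of _ "[Eps (Suc q') i', Eta q' j, Eta (Suc q') (Suc k')]"])
        (use less h_greater assms in \<open>fastforce intro: sreds_intros\<close>)
  next
    case id
    show ?thesis
      by (rule exI[of _ "[Eta q j]"]) (use id h_greater assms in \<open>fastforce intro: sreds_intros\<close>)
  next
    case greater
    obtain m q' where [simp]: "i' = Suc m" "q = Suc q'"
      using greater h_greater by (cases i'; cases q) auto
    show ?thesis
      by (rule exI[of _ "[Eps (Suc q') m, Eta q' j, Eta (Suc q') (Suc k)]"])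
        (use greater h_greater assms in \<open>fastforce intro: sreds_intros\<close>)
  qed
qed

text \<open>The source is \<open>[Eta n l, Eps (Suc q) i, Eps q j]\<close>. The eta moves right past
  both epsilons or cancels against one; if both survive, \<open>f\<close> sorts them on the side
  where \<open>h\<close> came first.\<close>

lemma critical_pair_hf:
  assumes "1 \<le> q" "i \<le> j" "j \<le> q" and "srule [Eta n l, Eps (Suc q) i] r"
  shows "\<exists>s. sred\<^sup>*\<^sup>* (r @ [Eps q j]) s \<and> sred\<^sup>*\<^sup>* [Eta n l, Eps (Suc q) (Suc j), Eps q i] s"
  using assms(4)
proof cases
  case (h_less k p)
  consider (less) "j < k" | (id) "j = k \<or> j = Suc k" | (greater) "Suc k < j" by linarith
  then show ?thesis
  proof cases
    case less
    obtain k' p' where [simp]: "k = Suc k'" "p = Suc p'"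
      using less h_less by (cases k; cases p) auto
    show ?thesis
      by (rule exI[of _ "[Eps (Suc (Suc p')) (Suc j), Eps (Suc p') i, Eta p' k']"])
        (use less h_less assms in \<open>fastforce intro: sreds_intros\<close>)
  next
    case id
    show ?thesis
      by (rule exI[of _ "[Eps (Suc p) i]"]) (use id h_less assms in \<open>fastforce intro: sreds_intros\<close>)
  next
    case greater
    obtain m p' where [simp]: "j = Suc m" "p = Suc p'"
      using greater h_less assms by (cases j; cases p) auto
    show ?thesis
      by (rule exI[of _ "[Eps (Suc (Suc p')) (Suc m), Eps (Suc p') i, Eta p' k]"])
        (use greater h_less assms in \<open>fastforce intro: sreds_intros\<close>)
  qed
next
  case h_id
  have "sred\<^sup>*\<^sup>* [Eta q l, Eps (Suc q) (Suc j), Eps q i] [Eps q j]"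
  \<comment> \<open>If \<open>j = l\<close>, then \<open>i = j\<close> and the eta cancels against
    the first epsilon. Otherwise \<open>l < j\<close>, and it passes the first epsilon and cancels
    against the second.\<close>
  proof (cases "j = l")
    case True
    then show ?thesis using h_id assms(2,3) by (fastforce intro: sreds_intros)
  next
    case False
    obtain p where "q = Suc p" using assms(1) by (cases q) auto
    moreover from this have "l < j" "l \<le> p" using False h_id assms(2,3) by auto
    ultimately show ?thesis using h_id(3) assms(3) by (fastforce intro: sreds_intros)
  qed
  then show ?thesis using h_id by auto
next
  case (h_greater i' p)
  obtain m p' where [simp]: "j = Suc m" "p = Suc p'"
    using h_greater assms by (cases j; cases p) auto
  show ?thesis
    by (rule exI[of _ "[Eps (Suc (Suc p')) (Suc m), Eps (Suc p') i', Eta p' l]"])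
      (use h_greater assms in \<open>fastforce intro: sreds_intros\<close>)
qed

text \<open>The shared letter selects a rule: an epsilon begins only the left-hand side of
  \<open>f\<close>, an eta ends only that of \<open>g\<close>. The remaining outer letter separates
  the four cases.\<close>

lemma critical_pair_joinable:
  assumes "srule [x, y] r" "srule [y, z] r'"
  shows "\<exists>s. sred\<^sup>*\<^sup>* (r @ [z]) s \<and> sred\<^sup>*\<^sup>* (x # r') s"
proof (cases y)
  case (Eps p i)
  with assms(2) obtain q j where f: "y = Eps (Suc q) i" "z = Eps q j" "1 \<le> q" "i \<le> j" "j \<le> q"
    "r' = [Eps (Suc q) (Suc j), Eps q i]"
    by (auto elim!: srule.cases)
  show ?thesis
  proof (cases x)
    case Eps
    then show ?thesis using assms(1) f by (auto elim!: srule.cases intro!: critical_pair_ff)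
  next
    case Eta
    then show ?thesis using critical_pair_hf[of q i j _ _ r] assms(1) f by simp
  qed
next
  case (Eta p j)
  with assms(1) obtain q k where g: "x = Eta q k" "y = Eta (Suc q) j" "j \<le> k" "k \<le> q"
    "r = [Eta q j, Eta (Suc q) (Suc k)]"
    by (auto elim!: srule.cases)
  show ?thesis
  proof (cases z)
    case Eta
    then show ?thesis using assms(2) g by (auto elim!: srule.cases intro!: critical_pair_gg)
  next
    case (Eps p' i)
    moreover from this have "p' = Suc (Suc q)" using assms(2) g by (auto elim!: srule.cases)
    ultimately show ?thesis using critical_pair_gh[of j k q i r'] assms(2) g by simp
  qed
qed

section \<open>Transfer from strings to words of the simplicial graph\<close>

lemma sred_append: "sred es es' \<Longrightarrow> sred (as @ es) (as @ es')"
  by (induction as) (auto intro: sred.Cons)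

interpretation simplicial: binomial_system simplicial_graph word_less1 simplicial_relations
proof unfold_locales
  fix u v a b :: sword
  assume "(u, v) \<in> simplicial_relations"
  then have "sred (letters a @ letters u @ letters b) (letters a @ letters v @ letters b)"
    using simplicial_relationsD by (intro sred_append sred.rule) blast
  from sred_word_less1[OF this] show "(a \<odot> v \<odot> b, a \<odot> u \<odot> b) \<in> word_less1"
    by (simp add: wcomp_def)
qed (use irrefl_word_less1 trans_word_less1 simplicial_relationsD in auto)

lemma rewr_of_sred:
  assumes "sred es es'" "Word y es x \<in> free_cat simplicial_graph"
  shows "simplicial.rewr (Word y es x) (Word y es' x) \<and> Word y es' x \<in> free_cat simplicial_graph"
  using assms
proof (induction arbitrary: y rule: sred.induct)
  case (rule l r es)
  then obtain z where z: "Word y l z \<in> free_cat simplicial_graph" "Word z es x \<in> free_cat simplicial_graph"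
    by (auto simp: simplicial.free_cat_append)
  note T = simplicial_relationsI[OF rule(1) z(1)]
  have "simplicial.rewr (Word y l z \<odot> Word z es x) (Word y r z \<odot> Word z es x)"
    using T z(2) by (rule simplicial.rewr_rule_left) (simp add: composable_def)
  then show ?case using simplicial_relationsD[OF T] z(2)
    by (auto simp: wcomp_def simplicial.free_cat_append)
next
  case (Cons es es' e)
  then have e: "e \<in> arcs simplicial_graph" "sarc_head e = y"
    and es: "Word (sarc_tail e) es x \<in> free_cat simplicial_graph"
    by (auto simp: simplicial.free_cat_Cons)
  have "Word y [e] (sarc_tail e) \<in> free_cat simplicial_graph"
    using e by (simp add: simplicial.free_cat_Cons simplicial.free_cat_Nil)
  with Cons.IH[OF es] simplicial.rewr_wcomp_left[of _ _ "Word y [e] (sarc_tail e)"] e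
  show ?case by (fastforce simp: wcomp_def composable_def simplicial.free_cat_Cons)
qed

lemma rewrs_of_sreds:
  assumes "sred\<^sup>*\<^sup>* es es'" "Word y es x \<in> free_cat simplicial_graph"
  shows "simplicial.rewr\<^sup>*\<^sup>* (Word y es x) (Word y es' x)"
  using assms
  by (induction rule: converse_rtranclp_induct)
    (auto dest: rewr_of_sred intro: converse_rtranclp_into_rtranclp)

theorem theorem5p1:
  "gs_basis simplicial_graph word_less1
     (rel_poly ` simplicial_relations :: ((nat, sarc) word \<Rightarrow>\<^sub>0 'k::field) set)"
proof (rule simplicial.gs_basis_of_joinable)
  fix u v u' v' a b :: sword
  assume T: "(u, v) \<in> simplicial_relations" "(u', v') \<in> simplicial_relations"
    and comp: "composable a u'" "composable u' b" and u: "u = a \<odot> u' \<odot> b"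
  note D = simplicial_relationsD[OF T(1)] simplicial_relationsD[OF T(2)]
  \<comment> \<open>Both left-hand sides have length two, so the context is empty and, the rules
    being functional, the reducts coincide.\<close>
  have "letters a = []" "letters b = []"
    using D srule_length[of "letters u"] srule_length[of "letters u'"] u by auto
  moreover from this have "letters v = letters v'"
    using D u srule_functional by auto
  ultimately have "v = a \<odot> v' \<odot> b"
    using D u by (intro word.expand) auto
  then show "\<exists>z. simplicial.rewr\<^sup>*\<^sup>* v z \<and> simplicial.rewr\<^sup>*\<^sup>* (a \<odot> v' \<odot> b) z" by blast
next
  fix u v u' v' a b :: sword
  assume T: "(u, v) \<in> simplicial_relations" "(u', v') \<in> simplicial_relations"
    and fc: "a \<in> free_cat simplicial_graph" "b \<in> free_cat simplicial_graph"
    and comp: "composable u b" "composable a u'" and eq: "u \<odot> b = a \<odot> u'"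
    and less: "length (letters b) < length (letters u')"
  note D = simplicial_relationsD[OF T(1)] simplicial_relationsD[OF T(2)]
  have len: "length (letters u) = 2" "length (letters u') = 2"
    using D srule_length by blast+
  have ends: "tgt a = tgt u" "src b = src u'" and ls: "letters u @ letters b = letters a @ letters u'"
    using arg_cong[OF eq, of tgt] arg_cong[OF eq, of src] arg_cong[OF eq, of letters] by simp_all
  have vb: "v \<odot> b = Word (tgt u) (letters v @ letters b) (src u')"
    and av: "a \<odot> v' = Word (tgt u) (letters a @ letters v') (src u')"
    using D ends by (simp_all add: wcomp_def)
  have "v \<odot> b \<in> free_cat simplicial_graph" "a \<odot> v' \<in> free_cat simplicial_graph"
    using D fc comp by (auto intro!: simplicial.free_cat_wcomp simp: composable_def)
  note rewrs = this[unfolded vb av, THEN rewrs_of_sreds[rotated]]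
  have "\<exists>s. sred\<^sup>*\<^sup>* (letters v @ letters b) s \<and> sred\<^sup>*\<^sup>* (letters a @ letters v') s"
  \<comment> \<open>Length two leaves a complete overlap, where the reducts agree, or an overlap in
    one letter, which is a critical pair.\<close>
  proof (cases "letters b = []")
    case True
    then have "letters a = []" "letters u = letters u'"
      using ls len arg_cong[OF ls, of length] by auto
    with D srule_functional[of "letters u" "letters v" "letters v'"] True show ?thesis by auto
  next
    case False
    then obtain x y z where "letters b = [z]" "letters a = [x]" "letters u = [x, y]" "letters u' = [y, z]"
      using ls len less by (auto simp: length_Suc_conv numeral_2_eq_2 less_Suc_eq append_eq_Cons_conv Cons_eq_append_conv dest!: sym[of "[_]"])
    with D critical_pair_joinable[of x y "letters v" z "letters v'"] show ?thesis by simp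
  qed
  then show "\<exists>z. simplicial.rewr\<^sup>*\<^sup>* (v \<odot> b) z \<and> simplicial.rewr\<^sup>*\<^sup>* (a \<odot> v') z"
    unfolding vb av using rewrs by blast
qed

end
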